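(* There are Stäckel-compact spaces $Y, Z$ such that $Y \times Z$ (with the product topology) is not countably compact, so Stäckel-compactness is not a productive property (that is, the product of two Stäckel-compact spaces need not be Stäckel-compact).
   Context: Work in ZFC. A Hausdorff topological space $X$ is Stäckel-compact if there is a linear (total) order $\prec$ on the set $X$ such that every non-empty closed subset of $X$ has a $\prec$-least and a $\prec$-greatest element; $\prec$ is not assumed to be related to the topology of $X$ in any other way. *)

theory Defs
  imports "HOL-Analysis.Analysis"
begin

text \<open>Analogue for abstract topologies of the library's \<^const>\<open>countably_compact\<close>, which is
  only available for sets in type-class topologies.\<close>

definition countably_compact_space :: "'a topology \<Rightarrow> bool" where
  "countably_compact_space X \<longleftrightarrow>
     (\<forall>\<U>. countable \<U> \<and> (\<forall>U\<in>\<U>. openin X U) \<and> topspace X \<subseteq> \<Union>\<U>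
        \<longrightarrow> (\<exists>\<F>. finite \<F> \<and> \<F> \<subseteq> \<U> \<and> topspace X \<subseteq> \<Union>\<F>))"

text \<open>The relation \<open>r\<close> is the reflexive closure of the strict order \<open>\<prec>\<close>; it need not be related
  to the topology in any way beyond the stated condition.\<close>

definition Staeckel_compact_space :: "'a topology \<Rightarrow> bool" where
  "Staeckel_compact_space X \<longleftrightarrow>
     Hausdorff_space X \<and>
     (\<exists>r. linear_order_on (topspace X) r \<and>
        (\<forall>C. closedin X C \<and> C \<noteq> {} \<longrightarrow>
           (\<exists>l\<in>C. \<forall>x\<in>C. (l, x) \<in> r) \<and> (\<exists>g\<in>C. \<forall>x\<in>C. (x, g) \<in> r)))"

end

theory Submission
  imports Defs
begin

text \<open>
  The two factors are subspaces of the Stone space of ultrafilters on \<open>\<nat>\<close>.  An order with the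
  required property on a Hausdorff space \<open>X\<close> exists as soon as \<open>X\<close> splits into two parts each of
  which meets every infinite closed set: well-order the first part and place the second part after
  it in a reversed well-order (\<open>Staeckel_compact_if_split\<close>).

  Suppose that pairwise disjoint sets \<open>P 0\<close>, \<open>P 1\<close>, \<open>P 2\<close>, \<open>P 3\<close> of ultrafilters are such that, for
  every sequence \<open>p\<close> of ultrafilters that have pairwise disjoint members \<open>A n \<in> p n\<close>, each \<open>P j\<close>
  contains a limit of \<open>p\<close> along some ultrafilter.  Every infinite set of ultrafilters contains such a sequence
  (\<open>infinite_strongly_discrete\<close>), and the limits that belong to a subspace belong to every closed
  subset of it that contains the sequence.  Hence the union \<open>Y\<close> of \<open>P 0\<close>, \<open>P 1\<close> and the principal
  ultrafilters, and the union \<open>Z\<close> of \<open>P 2\<close>, \<open>P 3\<close> and the principal ultrafilters, are both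
  Staeckel-compact.  Only the principal ultrafilters are common to \<open>Y\<close> and \<open>Z\<close>, so the diagonal of
  the product is an infinite closed set all of whose points are isolated, and \<open>Y \<times> Z\<close> is not
  countably compact.  It is then not Staeckel-compact either, because in a Staeckel-compact
  space that is not countably compact there would be an infinite set all of whose nonempty subsets
  have a least and a greatest element.

  The sets \<open>P j\<close> come from a transfinite recursion (\<open>disjoint_sets_of_limits\<close>) that assigns to each
  pair of such a sequence \<open>p\<close> and a number \<open>j\<close> a limit of \<open>p\<close> not assigned before.  It never gets stuck,
  for reasons of cardinality: distinct ultrafilters give distinct limits of \<open>p\<close> (\<open>inj_on_ulim\<close>),
  there are as many ultrafilters as sets of sets of natural numbers, by means of an independent
  family (\<open>many_ultrafilters\<close>), and there are no more pairs than that (\<open>inj_sequences_into_sets\<close>).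
\<close>

section \<open>Linear orders with least and greatest elements\<close>

lemma finite_linear_order_least:
  assumes "linear_order_on S r" "finite C" "C \<noteq> {}" "C \<subseteq> S"
  shows "\<exists>l\<in>C. \<forall>x\<in>C. (l, x) \<in> r"
  using assms(2-4)
proof (induction C rule: finite_ne_induct)
  case (singleton x)
  then show ?case
    using assms(1) by (auto simp: order_on_defs refl_on_def)
next
  case (insert x F)
  then obtain l where l: "l \<in> F" "\<forall>y\<in>F. (l, y) \<in> r" by auto
  have tr: "trans r" and rf: "(x, x) \<in> r" and tot: "(l, x) \<in> r \<or> (x, l) \<in> r"
    using assms(1) l(1) insert.prems insert.hyps
    by (auto simp: order_on_defs refl_on_def total_on_def)
  show ?case
    using tot
  proof
    assume "(l, x) \<in> r"
    then show ?thesis using l by auto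
  next
    assume "(x, l) \<in> r"
    then have "\<forall>y\<in>insert x F. (x, y) \<in> r"
      using l(2) rf tr by (auto dest: transD)
    then show ?thesis by auto
  qed
qed

lemma finite_linear_order_greatest:
  assumes "linear_order_on S r" "finite C" "C \<noteq> {}" "C \<subseteq> S"
  shows "\<exists>g\<in>C. \<forall>x\<in>C. (x, g) \<in> r"
  using finite_linear_order_least[of S "r\<inverse>" C] assms by simp

text \<open>A linear order that is well-founded in both directions is finite.\<close>

lemma finite_if_subsets_have_least_and_greatest:
  assumes r: "linear_order_on S r" and "D \<subseteq> S"
    and ends: "\<And>C. C \<subseteq> D \<Longrightarrow> C \<noteq> {} \<Longrightarrow>
       (\<exists>l\<in>C. \<forall>x\<in>C. (l, x) \<in> r) \<and> (\<exists>g\<in>C. \<forall>x\<in>C. (x, g) \<in> r)"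
  shows "finite D"
proof -
  define below where "below x = {y \<in> D. (y, x) \<in> r}" for x
  have fin_below: "finite (below x)" if "x \<in> D" for x
  proof (rule ccontr)
    assume inf: "infinite (below x)"
    \<comment> \<open>The least \<open>e\<close> with infinitely many elements below it would have an immediate predecessor,
      with only finitely many below.\<close>
    define E where "E = {x \<in> D. infinite (below x)}"
    have "E \<noteq> {}" "E \<subseteq> D" using that inf by (auto simp: E_def)
    from ends[OF this(2,1)] obtain e where e: "e \<in> E" "\<And>x. x \<in> E \<Longrightarrow> (e, x) \<in> r" by blast
    have "infinite (below e)" using e by (simp add: E_def)
    then have "infinite (below e - {e})" by simp
    then have "below e - {e} \<noteq> {}" by (metis finite.emptyI)
    then obtain g where g: "g \<in> below e - {e}" "\<And>y. y \<in> below e - {e} \<Longrightarrow> (y, g) \<in> r"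
      using ends[of "below e - {e}"] by (auto simp: below_def)
    have "(e, g) \<notin> r"
      using r g(1) by (auto simp: order_on_defs below_def antisym_def)
    then have "g \<notin> E" using e by auto
    then have "finite (below g)" using g(1) by (auto simp: E_def below_def)
    moreover have "below e - {e} \<subseteq> below g" using g(2) by (auto simp: below_def)
    ultimately show False using \<open>infinite (below e - {e})\<close> finite_subset by blast
  qed
  show "finite D"
  proof (cases "D = {}")
    case False
    with ends[of D] obtain g where "g \<in> D" "\<And>x. x \<in> D \<Longrightarrow> (x, g) \<in> r" by blast
    then have "D = below g" by (auto simp: below_def)
    with fin_below[OF \<open>g \<in> D\<close>] show ?thesis by simp
  qed simp
qed

section \<open>Staeckel-compactness and countable compactness\<close>

lemma Staeckel_compact_imp_countably_compact:
  assumes "Staeckel_compact_space X"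
  shows "countably_compact_space X"
  unfolding countably_compact_space_def
proof (intro allI impI, rule ccontr)
  fix \<U>
  assume \<U>: "countable \<U> \<and> (\<forall>U\<in>\<U>. openin X U) \<and> topspace X \<subseteq> \<Union>\<U>"
    and nofin: "\<nexists>\<F>. finite \<F> \<and> \<F> \<subseteq> \<U> \<and> topspace X \<subseteq> \<Union>\<F>"
  have ne: "\<U> \<noteq> {}" using \<U> nofin by (metis finite.emptyI subset_refl)
  define U where "U = from_nat_into \<U>"
  have rangeU: "range U = \<U>" using \<U> ne by (simp add: U_def)
  have openU: "openin X (U n)" for n using \<U> rangeU by blast
  have "\<exists>x. x \<in> topspace X \<and> x \<notin> \<Union>(U ` {..<n})" for n
  proof (rule ccontr)
    assume "\<not> ?thesis"
    then have "topspace X \<subseteq> \<Union>(U ` {..<n})" by blast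
    moreover have "U ` {..<n} \<subseteq> \<U>" using rangeU by blast
    ultimately show False using nofin by (metis finite_imageI finite_lessThan)
  qed
  then obtain x where x: "\<And>n. x n \<in> topspace X" "\<And>n i. i < n \<Longrightarrow> x n \<notin> U i"
    by (metis UN_iff lessThan_iff)
  have haus: "Hausdorff_space X" using assms by (simp add: Staeckel_compact_space_def)
  \<comment> \<open>Each \<open>U i\<close> contains \<open>x n\<close> for \<open>n \<le> i\<close> only, so the range of \<open>x\<close> is closed and discrete.\<close>
  have finU: "finite (U i \<inter> range x)" for i
  proof -
    have "U i \<inter> range x \<subseteq> x ` {..i}" using x(2) by (auto simp: not_le[symmetric])
    then show ?thesis by (rule finite_subset) simp
  qed
  have closed: "closedin X C" if C: "C \<subseteq> range x" for C
  proof -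
    have "openin X (topspace X - C)"
    proof (subst openin_subopen, intro ballI)
      fix y assume y: "y \<in> topspace X - C"
      then obtain i where i: "y \<in> U i" using \<U> rangeU by blast
      have "finite (U i \<inter> C)" using finU[of i] C by (meson Int_mono finite_subset subset_refl)
      moreover have "U i \<inter> C \<subseteq> topspace X" using openU openin_subset by blast
      ultimately have "closedin X (U i \<inter> C)"
        using haus by (simp add: closedin_Hausdorff_finite)
      then have "openin X (U i - U i \<inter> C)" using openU by (simp add: openin_diff)
      moreover have "U i - U i \<inter> C \<subseteq> topspace X - C"
        using openin_subset[OF openU] by blast
      ultimately show "\<exists>T. openin X T \<and> y \<in> T \<and> T \<subseteq> topspace X - C" using i y by blast
    qed
    moreover have "C \<subseteq> topspace X" using C x(1) by blast
    ultimately show ?thesis by (simp add: closedin_def)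
  qed
  obtain r where r: "linear_order_on (topspace X) r"
    and ends: "\<And>C. closedin X C \<Longrightarrow> C \<noteq> {} \<Longrightarrow>
       (\<exists>l\<in>C. \<forall>x\<in>C. (l, x) \<in> r) \<and> (\<exists>g\<in>C. \<forall>x\<in>C. (x, g) \<in> r)"
    using assms unfolding Staeckel_compact_space_def by metis
  have "finite (range x)"
    by (rule finite_if_subsets_have_least_and_greatest[OF r]) (use x(1) closed ends in auto)
  then obtain y where "y \<in> range x" and inf: "infinite (x -` {y} \<inter> UNIV)"
    using inf_img_fin_domE'[of x UNIV] by auto
  then obtain i where i: "y \<in> U i" using x(1) \<U> rangeU by blast
  have "x -` {y} \<subseteq> {..i}" using i x(2) by (auto simp: not_le[symmetric])
  then show False using inf by (metis finite_atMost finite_subset inf_top_right)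
qed

text \<open>The sufficient condition behind the example: order a set \<open>A\<close> by a well-order and place its
  complement after it, ordered by the converse of a well-order.  A closed set that meets both parts
  has both extreme elements.\<close>

lemma Staeckel_compact_if_split:
  assumes haus: "Hausdorff_space X"
    and meet: "\<And>C. closedin X C \<Longrightarrow> infinite C \<Longrightarrow> C \<inter> A \<noteq> {} \<and> C - A \<noteq> {}"
  shows "Staeckel_compact_space X"
proof -
  obtain w :: "('a \<times> 'a) set" where w: "well_order_on UNIV w"
    using well_order_on by blast
  then have lin: "linear_order_on UNIV w" by (simp add: well_order_on_def)
  have least: "\<exists>l\<in>C. \<forall>x\<in>C. (l, x) \<in> w" if "C \<noteq> {}" for C
  proof -
    have "Field w = UNIV" "Well_order w" using w well_order_on_Well_order by auto
    then have "\<exists>l. wo_rel.isMinim w C l"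
      using wo_rel.Well_order_isMinim_exists[of w C] that by (simp add: wo_rel_def)
    then show ?thesis using \<open>Well_order w\<close> by (auto simp: wo_rel.isMinim_def wo_rel_def)
  qed
  define S where "S = topspace X"
  define r where "r = {(x, y). x \<in> S \<and> y \<in> S \<and>
     (if x \<in> A then y \<in> A \<longrightarrow> (x, y) \<in> w else y \<notin> A \<and> (y, x) \<in> w)}"
  have r: "linear_order_on S r"
    unfolding order_on_defs
  proof (intro conjI)
    show "r \<subseteq> S \<times> S" by (auto simp: r_def)
    show "refl_on S r" using lin by (auto simp: order_on_defs refl_on_def r_def)
    show "trans r"
      using lin by (auto simp: order_on_defs r_def split: if_splits intro!: transI dest: transD)
    show "antisym r"
      using lin by (auto simp: order_on_defs r_def split: if_splits intro!: antisymI dest: antisymD)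
    show "total_on S r" using lin by (auto simp: order_on_defs total_on_def r_def)
  qed
  have "(\<exists>l\<in>C. \<forall>x\<in>C. (l, x) \<in> r) \<and> (\<exists>g\<in>C. \<forall>x\<in>C. (x, g) \<in> r)"
    if C: "closedin X C" "C \<noteq> {}" for C
  proof (cases "finite C")
    case True
    then show ?thesis
      using finite_linear_order_least[OF r] finite_linear_order_greatest[OF r] C
        closedin_subset S_def by metis
  next
    case False
    have CS: "C \<subseteq> S" using closedin_subset[OF C(1)] by (simp add: S_def)
    obtain l where "l \<in> C \<inter> A" "\<forall>x\<in>C \<inter> A. (l, x) \<in> w"
      using least meet[OF C(1) False] by meson
    then have "l \<in> C \<and> (\<forall>x\<in>C. (l, x) \<in> r)" using CS by (auto simp: r_def)
    moreover obtain g where "g \<in> C - A" "\<forall>x\<in>C - A. (g, x) \<in> w"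
      using least meet[OF C(1) False] by meson
    then have "g \<in> C \<and> (\<forall>x\<in>C. (x, g) \<in> r)" using CS by (auto simp: r_def)
    ultimately show ?thesis by blast
  qed
  with haus r show ?thesis unfolding Staeckel_compact_space_def S_def by blast
qed

section \<open>Ultrafilters\<close>

text \<open>An ultrafilter, as the set of its members: membership commutes with intersection and
  complement.  Properness and upward closure follow.\<close>

definition ultrafilter :: "'a set set \<Rightarrow> bool" where
  "ultrafilter u \<longleftrightarrow> (\<forall>A B. A \<inter> B \<in> u \<longleftrightarrow> A \<in> u \<and> B \<in> u) \<and> (\<forall>A. - A \<in> u \<longleftrightarrow> A \<notin> u)"

lemma ultrafilter_Int: "ultrafilter u \<Longrightarrow> A \<inter> B \<in> u \<longleftrightarrow> A \<in> u \<and> B \<in> u"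
  and ultrafilter_Compl: "ultrafilter u \<Longrightarrow> - A \<in> u \<longleftrightarrow> A \<notin> u"
  by (simp_all add: ultrafilter_def)

lemma ultrafilter_mono: "ultrafilter u \<Longrightarrow> A \<in> u \<Longrightarrow> A \<subseteq> B \<Longrightarrow> B \<in> u"
  using ultrafilter_Int[of u A B] by (simp add: Int_absorb2)

lemma ultrafilter_empty: "ultrafilter u \<Longrightarrow> {} \<notin> u"
  using ultrafilter_mono[of u "{}" UNIV] ultrafilter_Compl[of u "{}"] by auto

lemma ultrafilter_UNIV: "ultrafilter u \<Longrightarrow> UNIV \<in> u"
  using ultrafilter_empty[of u] ultrafilter_Compl[of u "{}"] by simp

lemma ultrafilter_Diff: "ultrafilter u \<Longrightarrow> A - B \<in> u \<longleftrightarrow> A \<in> u \<and> B \<notin> u"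
  by (simp add: Diff_eq ultrafilter_Int ultrafilter_Compl)

lemma ultrafilters_separated:
  assumes "ultrafilter u" "ultrafilter v" "u \<noteq> v"
  obtains A where "A \<in> u" "A \<notin> v"
proof (cases "u \<subseteq> v")
  case True
  then obtain A where "A \<in> v" "A \<notin> u" using assms(3) by blast
  then show thesis using that[of "- A"] assms by (simp add: ultrafilter_Compl)
qed (use that in blast)

text \<open>The ultrafilter lemma: the ultrafilter is a maximal extension of \<open>\<F>\<close> with the finite
  intersection property.\<close>

lemma ultrafilter_extending:
  assumes fip: "\<And>F. finite F \<Longrightarrow> F \<subseteq> \<F> \<Longrightarrow> \<Inter>F \<noteq> {}"
  obtains u where "ultrafilter u" "\<F> \<subseteq> u"
proof -
  define P where "P \<G> \<longleftrightarrow> (\<forall>F. finite F \<longrightarrow> F \<subseteq> \<G> \<longrightarrow> \<Inter>F \<noteq> {})" for \<G> :: "'a set set"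
  have "\<exists>M\<in>{\<G>. \<F> \<subseteq> \<G> \<and> P \<G>}. \<forall>\<G>\<in>{\<G>. \<F> \<subseteq> \<G> \<and> P \<G>}. M \<subseteq> \<G> \<longrightarrow> \<G> = M"
  proof (rule subset_Zorn_nonempty)
    show "{\<G>. \<F> \<subseteq> \<G> \<and> P \<G>} \<noteq> {}" using fip by (auto simp: P_def)
  next
    fix \<C> assume ne: "\<C> \<noteq> {}" and chain: "subset.chain {\<G>. \<F> \<subseteq> \<G> \<and> P \<G>} \<C>"
    have "P (\<Union>\<C>)"
      unfolding P_def
    proof (intro allI impI)
      fix F assume "finite F" "F \<subseteq> \<Union>\<C>"
      then obtain \<G> where "\<G> \<in> \<C>" "F \<subseteq> \<G>"
        using finite_subset_Union_chain[OF _ _ ne chain] by metis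
      then show "\<Inter>F \<noteq> {}"
        using chain \<open>finite F\<close> by (auto simp: subset_chain_def P_def)
    qed
    then show "\<Union>\<C> \<in> {\<G>. \<F> \<subseteq> \<G> \<and> P \<G>}"
      using ne chain unfolding subset_chain_def by blast
  qed
  then obtain u where u: "\<F> \<subseteq> u" "P u"
    and max: "\<forall>\<G>\<in>{\<G>. \<F> \<subseteq> \<G> \<and> P \<G>}. u \<subseteq> \<G> \<longrightarrow> \<G> = u"
    by (elim bexE CollectE conjE)
  have ins: "\<exists>F. finite F \<and> F \<subseteq> u \<and> A \<inter> \<Inter>F = {}" if "A \<notin> u" for A
  proof -
    have "\<not> P (insert A u)"
      using bspec[OF max, of "insert A u"] u(1) that
      by (metis insertI1 mem_Collect_eq subset_insertI subset_trans)
    then obtain F where F: "finite F" "F \<subseteq> insert A u" "\<Inter>F = {}" by (auto simp: P_def)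
    have "A \<inter> \<Inter>(F - {A}) = {}" using F(3) by blast
    with F show ?thesis by (intro exI[of _ "F - {A}"]) auto
  qed
  have ne: "\<Inter>F \<noteq> {}" if "finite F" "F \<subseteq> u" for F using u(2) that by (auto simp: P_def)
  have mem: "A \<in> u" if F: "finite F" "F \<subseteq> u" "\<Inter>F \<subseteq> A" for A F
  proof (rule ccontr)
    assume "A \<notin> u"
    then obtain G where G: "finite G" "G \<subseteq> u" "A \<inter> \<Inter>G = {}" using ins[of A] by metis
    have "\<Inter>(F \<union> G) = {}" using F(3) G(3) by (simp only: Inter_Un_distrib) blast
    then show False using ne[of "F \<union> G"] F G by simp
  qed
  have "ultrafilter u"
    unfolding ultrafilter_def
  proof (intro conjI allI iffI)
    fix A B
    show "A \<in> u" if "A \<inter> B \<in> u" using mem[of "{A \<inter> B}"] that by auto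
    show "B \<in> u" if "A \<inter> B \<in> u" using mem[of "{A \<inter> B}"] that by auto
    show "A \<inter> B \<in> u" if "A \<in> u \<and> B \<in> u" using mem[of "{A, B}"] that by auto
  next
    fix A
    show "A \<notin> u" if "- A \<in> u" using ne[of "{A, - A}"] that by auto
    show "- A \<in> u" if A: "A \<notin> u"
    proof -
      obtain F where "finite F" "F \<subseteq> u" "A \<inter> \<Inter>F = {}" using ins[OF A] by metis
      then show ?thesis using mem[of F "- A"] by (auto simp: disjoint_eq_subset_Compl)
    qed
  qed
  with u(1) that show thesis by blast
qed

text \<open>The principal ultrafilter of a point.\<close>

definition principal_uf :: "'a \<Rightarrow> 'a set set" where
  "principal_uf a = {A. a \<in> A}"

lemma ultrafilter_principal_uf: "ultrafilter (principal_uf a)"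
  by (auto simp: ultrafilter_def principal_uf_def)

lemma ultrafilter_singleton: "ultrafilter u \<Longrightarrow> {a} \<in> u \<longleftrightarrow> u = principal_uf a"
proof
  assume u: "ultrafilter u" and a: "{a} \<in> u"
  have "A \<in> u \<longleftrightarrow> a \<in> A" for A
  proof
    assume "A \<in> u"
    with u a have "{a} \<inter> A \<in> u" by (simp add: ultrafilter_Int)
    then have "{a} \<inter> A \<noteq> {}" using ultrafilter_empty[OF u] by metis
    then show "a \<in> A" by simp
  next
    assume "a \<in> A"
    then show "A \<in> u" using ultrafilter_mono[OF u a] by simp
  qed
  then show "u = principal_uf a" by (auto simp: principal_uf_def)
qed (auto simp: principal_uf_def)

lemma inj_principal_uf: "inj principal_uf"
proof (rule injI)
  fix a b :: 'a
  assume eq: "principal_uf a = principal_uf b"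
  have "{a} \<in> principal_uf a" by (simp add: principal_uf_def)
  then show "a = b" unfolding eq by (simp add: principal_uf_def)
qed

text \<open>The members of an independent family, indexed by the sets \<open>X\<close> of natural numbers.  A number
  codes a length \<open>n\<close> and a list of bit strings; \<open>X\<close> selects the codes whose list contains the first
  \<open>n\<close> bits of \<open>X\<close>.\<close>

definition indep :: "nat set \<Rightarrow> nat set" where
  "indep X = {k. case from_nat k :: nat \<times> bool list list of
     (n, L) \<Rightarrow> map (\<lambda>i. i \<in> X) [0..<n] \<in> set L}"

text \<open>Finitely many sets are told apart by their first \<open>n\<close> bits, for some \<open>n\<close>.\<close>

lemma finite_sets_separated:
  assumes "finite (\<A> :: nat set set)"
  obtains n where "inj_on (\<lambda>X. map (\<lambda>i. i \<in> X) [0..<n]) \<A>"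
proof -
  have "\<exists>d. \<forall>X Y. X \<noteq> Y \<longrightarrow> \<not> (d X Y \<in> X \<longleftrightarrow> d X Y \<in> (Y :: nat set))"
    by (intro choice allI) blast
  then obtain d where d: "\<And>X Y. X \<noteq> Y \<Longrightarrow> \<not> (d X Y \<in> X \<longleftrightarrow> d X Y \<in> (Y :: nat set))"
    by blast
  have "finite ((\<lambda>(X, Y). d X Y) ` (\<A> \<times> \<A>))" using assms by simp
  then obtain n where n: "\<And>X Y. X \<in> \<A> \<Longrightarrow> Y \<in> \<A> \<Longrightarrow> d X Y < n"
    by (fastforce simp: finite_nat_set_iff_bounded)
  have "inj_on (\<lambda>X. map (\<lambda>i. i \<in> X) [0..<n]) \<A>"
  proof (rule inj_onI, rule ccontr)
    fix X Y assume XY: "X \<in> \<A>" "Y \<in> \<A>" "X \<noteq> Y"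
      and "map (\<lambda>i. i \<in> X) [0..<n] = map (\<lambda>i. i \<in> Y) [0..<n]"
    then have "\<forall>i<n. i \<in> X \<longleftrightarrow> i \<in> Y" by (simp add: map_eq_conv)
    with n[OF XY(1,2)] d[OF XY(3)] show False by blast
  qed
  with that show thesis by blast
qed

lemma indep_independent:
  assumes "finite \<A>" "finite \<B>" "\<A> \<inter> \<B> = {}"
  shows "(\<Inter>X\<in>\<A>. indep X) \<inter> (\<Inter>X\<in>\<B>. - indep X) \<noteq> {}"
proof -
  obtain n where n: "inj_on (\<lambda>X. map (\<lambda>i. i \<in> X) [0..<n]) (\<A> \<union> \<B>)"
    using finite_sets_separated assms by (metis finite_UnI)
  define bits where "bits X = map (\<lambda>i. i \<in> X) [0..<n]" for X
  have "finite (bits ` \<A>)" using assms by simp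
  then obtain L where L: "set L = bits ` \<A>" using finite_list by blast
  have iff: "to_nat (n, L) \<in> indep X \<longleftrightarrow> bits X \<in> bits ` \<A>" for X
    by (simp add: indep_def L flip: bits_def)
  have "bits X \<notin> bits ` \<A>" if "X \<in> \<B>" for X
    using n that assms(3) unfolding bits_def[symmetric] by (auto simp: inj_on_def)
  with iff have "to_nat (n, L) \<in> (\<Inter>X\<in>\<A>. indep X) \<inter> (\<Inter>X\<in>\<B>. - indep X)" by blast
  then show ?thesis by blast
qed

text \<open>There are as many ultrafilters on \<open>\<nat>\<close> as sets of sets of natural numbers: independence allows
  to prescribe freely which \<open>indep X\<close> belong to an ultrafilter.\<close>

lemma many_ultrafilters:
  "\<exists>U :: nat set set \<Rightarrow> nat set set. inj U \<and> (\<forall>S. ultrafilter (U S))"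
proof -
  have "\<exists>u. ultrafilter u \<and> (\<forall>X. indep X \<in> u \<longleftrightarrow> X \<in> S)" for S
  proof -
    define \<F> where "\<F> = indep ` S \<union> (\<lambda>X. - indep X) ` (- S)"
    have "\<Inter>F \<noteq> {}" if F: "finite F" "F \<subseteq> \<F>" for F
    proof -
      have "finite (F \<inter> indep ` S)" "finite (F \<inter> (\<lambda>X. - indep X) ` (- S))" using F by auto
      then obtain \<A> \<B> where "\<A> \<subseteq> S" "finite \<A>" "F \<inter> indep ` S = indep ` \<A>"
        and "\<B> \<subseteq> - S" "finite \<B>" "F \<inter> (\<lambda>X. - indep X) ` (- S) = (\<lambda>X. - indep X) ` \<B>"
        by (meson finite_subset_image inf_le2)
      note AB = this
      have "F = F \<inter> indep ` S \<union> F \<inter> (\<lambda>X. - indep X) ` (- S)"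
        using F(2) unfolding \<F>_def by blast
      also have "\<dots> = indep ` \<A> \<union> (\<lambda>X. - indep X) ` \<B>" by (simp only: AB(3,6))
      finally have "\<Inter>F = (\<Inter>X\<in>\<A>. indep X) \<inter> (\<Inter>X\<in>\<B>. - indep X)"
        by (simp only: Inter_Un_distrib)
      moreover have "\<A> \<inter> \<B> = {}" using AB(1,4) by blast
      ultimately show ?thesis using indep_independent[of \<A> \<B>] AB(2,5) by simp
    qed
    then obtain u where u: "ultrafilter u" "\<F> \<subseteq> u" using ultrafilter_extending[of \<F>] by metis
    have "indep X \<in> u \<longleftrightarrow> X \<in> S" for X
    proof (cases "X \<in> S")
      case True
      then show ?thesis using u(2) by (auto simp: \<F>_def)
    next
      case False
      then have "- indep X \<in> u" using u(2) by (auto simp: \<F>_def)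
      then show ?thesis using False u(1) by (simp add: ultrafilter_Compl)
    qed
    with u(1) show ?thesis by blast
  qed
  then obtain U where U: "\<And>S. ultrafilter (U S)" "\<And>S X. indep X \<in> U S \<longleftrightarrow> X \<in> S" by metis
  have "inj U" by (rule injI) (metis U(2) set_eqI)
  with U(1) show ?thesis by blast
qed

section \<open>The Stone topology\<close>

text \<open>The Stone space of all ultrafilters on a type: the sets of all ultrafilters that contain a given
  set \<open>A\<close> form a base.  It is the Stone-Cech compactification of the discrete space.\<close>

definition stone_topology :: "'a set set topology" where
  "stone_topology = topology (\<lambda>U. U \<subseteq> Collect ultrafilter \<and>
     (\<forall>u\<in>U. \<exists>A\<in>u. \<forall>v. ultrafilter v \<longrightarrow> A \<in> v \<longrightarrow> v \<in> U))"

lemma openin_stone_topology: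
  fixes U :: "'a set set set"
  shows "openin stone_topology U \<longleftrightarrow> U \<subseteq> Collect ultrafilter \<and>
     (\<forall>u\<in>U. \<exists>A\<in>u. \<forall>v. ultrafilter v \<longrightarrow> A \<in> v \<longrightarrow> v \<in> U)"
proof -
  have "istopology (\<lambda>U :: 'a set set set. U \<subseteq> Collect ultrafilter \<and>
     (\<forall>u\<in>U. \<exists>A\<in>u. \<forall>v. ultrafilter v \<longrightarrow> A \<in> v \<longrightarrow> v \<in> U))" (is "istopology ?P")
    unfolding istopology_def
  proof (intro conjI allI impI)
    fix S T assume S: "?P S" and T: "?P T"
    show "S \<inter> T \<subseteq> Collect ultrafilter" using S by blast
    show "\<forall>u\<in>S \<inter> T. \<exists>A\<in>u. \<forall>v. ultrafilter v \<longrightarrow> A \<in> v \<longrightarrow> v \<in> S \<inter> T"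
    proof
      fix u assume u: "u \<in> S \<inter> T"
      obtain A where "A \<in> u" "\<forall>v. ultrafilter v \<longrightarrow> A \<in> v \<longrightarrow> v \<in> S" using S u by blast
      moreover obtain B where "B \<in> u" "\<forall>v. ultrafilter v \<longrightarrow> B \<in> v \<longrightarrow> v \<in> T" using T u by blast
      ultimately show "\<exists>A\<in>u. \<forall>v. ultrafilter v \<longrightarrow> A \<in> v \<longrightarrow> v \<in> S \<inter> T"
        using S u by (intro bexI[of _ "A \<inter> B"]) (auto simp: ultrafilter_Int)
    qed
  next
    fix \<K> assume "\<forall>K\<in>\<K>. ?P K"
    then show "\<Union>\<K> \<subseteq> Collect ultrafilter"
      and "\<forall>u\<in>\<Union>\<K>. \<exists>A\<in>u. \<forall>v. ultrafilter v \<longrightarrow> A \<in> v \<longrightarrow> v \<in> \<Union>\<K>"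
      by (blast, fast)
  qed
  then show ?thesis by (simp add: stone_topology_def topology_inverse')
qed

lemma openin_stone_basic: "openin stone_topology {u. ultrafilter u \<and> A \<in> u}"
  unfolding openin_stone_topology by blast

lemma topspace_stone_topology: "topspace stone_topology = Collect ultrafilter"
proof
  show "topspace stone_topology \<subseteq> Collect ultrafilter"
    using openin_topspace[of stone_topology] unfolding openin_stone_topology by blast
  have "openin stone_topology (Collect ultrafilter)"
    unfolding openin_stone_topology using ultrafilter_UNIV by blast
  then show "Collect ultrafilter \<subseteq> topspace stone_topology" by (rule openin_subset)
qed

lemma Hausdorff_stone_topology: "Hausdorff_space stone_topology"
  unfolding Hausdorff_space_def topspace_stone_topology
proof (intro allI impI)
  fix u v :: "'a set set"
  assume uv: "u \<in> Collect ultrafilter \<and> v \<in> Collect ultrafilter \<and> u \<noteq> v"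
  then obtain A where "A \<in> u" "A \<notin> v" using ultrafilters_separated by blast
  with uv show "\<exists>U V. openin stone_topology U \<and> openin stone_topology V \<and> u \<in> U \<and> v \<in> V \<and> disjnt U V"
    by (intro exI[of _ "{u. ultrafilter u \<and> A \<in> u}"] exI[of _ "{u. ultrafilter u \<and> - A \<in> u}"])
      (auto simp: openin_stone_basic ultrafilter_Compl disjnt_def)
qed

section \<open>Limits of discrete sequences of ultrafilters\<close>

text \<open>The limit of the family \<open>p\<close> of ultrafilters along the ultrafilter \<open>u\<close>.\<close>

definition ulim :: "'i set set \<Rightarrow> ('i \<Rightarrow> 'a set set) \<Rightarrow> 'a set set" where
  "ulim u p = {A. {i. A \<in> p i} \<in> u}"

lemma ultrafilter_ulim:
  assumes "ultrafilter u" "\<And>i. ultrafilter (p i)"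
  shows "ultrafilter (ulim u p)"
proof -
  have "{i. A \<inter> B \<in> p i} = {i. A \<in> p i} \<inter> {i. B \<in> p i}" "{i. - A \<in> p i} = - {i. A \<in> p i}" for A B
    using assms(2) by (auto simp: ultrafilter_Int ultrafilter_Compl)
  then show ?thesis
    using assms(1) by (simp add: ultrafilter_def ulim_def)
qed

lemma ulim_in_closed:
  assumes "closedin (subtopology stone_topology Y) C" "\<And>i. p i \<in> C"
    and "ultrafilter u" "ulim u p \<in> Y"
  shows "ulim u p \<in> C"
proof (rule ccontr)
  assume notin: "ulim u p \<notin> C"
  obtain T where T: "closedin stone_topology T" "C = T \<inter> Y"
    using assms(1) by (auto simp: closedin_subtopology)
  have uf: "ultrafilter (p i)" for i
    using closedin_subset[OF T(1)] T(2) assms(2) by (auto simp: topspace_stone_topology)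
  have "openin stone_topology (Collect ultrafilter - T)"
    using T(1) by (simp add: closedin_def topspace_stone_topology)
  moreover have "ulim u p \<in> Collect ultrafilter - T"
    using notin T(2) assms(4) ultrafilter_ulim[of u p, OF assms(3) uf] by blast
  ultimately obtain A where A: "A \<in> ulim u p"
    "\<And>v. ultrafilter v \<Longrightarrow> A \<in> v \<Longrightarrow> v \<in> Collect ultrafilter - T"
    unfolding openin_stone_topology by meson
  then have "{i. A \<in> p i} \<noteq> {}" using ultrafilter_empty[OF assms(3)] by (metis mem_Collect_eq ulim_def)
  then obtain i where "A \<in> p i" by blast
  with A(2)[OF uf] T(2) assms(2) show False by blast
qed

text \<open>A family of ultrafilters from which pairwise disjoint members can be selected.\<close>

definition strongly_discrete :: "('i \<Rightarrow> 'a set set) \<Rightarrow> bool" where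
  "strongly_discrete p \<longleftrightarrow> (\<forall>i. ultrafilter (p i)) \<and>
     (\<exists>A. disjoint_family A \<and> (\<forall>i. A i \<in> p i))"

text \<open>The ultrafilter \<open>u\<close> can be recovered from the limit: \<open>B \<in> u\<close> exactly if the limit contains the
  union of the disjoint members with index in \<open>B\<close>.\<close>

lemma inj_on_ulim:
  assumes "strongly_discrete p"
  shows "inj_on (\<lambda>u. ulim u p) (Collect ultrafilter)"
proof -
  obtain A where p: "\<And>i. ultrafilter (p i)" and A: "disjoint_family A" "\<And>i. A i \<in> p i"
    using assms by (auto simp: strongly_discrete_def)
  have "(\<Union>i\<in>B. A i) \<in> p j \<longleftrightarrow> j \<in> B" for B j
  proof
    assume "(\<Union>i\<in>B. A i) \<in> p j"
    then have "(\<Union>i\<in>B. A i) \<inter> A j \<noteq> {}"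
      using ultrafilter_Int[OF p] A(2) ultrafilter_empty[OF p] by metis
    then obtain i where i: "i \<in> B" "A i \<inter> A j \<noteq> {}" by blast
    then have "i = j" using A(1) unfolding disjoint_family_on_def by blast
    with i(1) show "j \<in> B" by simp
  next
    assume "j \<in> B"
    then show "(\<Union>i\<in>B. A i) \<in> p j" using ultrafilter_mono[OF p A(2)] by blast
  qed
  then have "(\<Union>i\<in>B. A i) \<in> ulim u p \<longleftrightarrow> B \<in> u" for B u by (simp add: ulim_def)
  then show ?thesis by (intro inj_onI) (metis set_eqI)
qed

text \<open>An infinite set of ultrafilters is split repeatedly.  The decreasing sets \<open>R n\<close> belong to
  infinitely many elements of \<open>C\<close> each, while \<open>R n - R (Suc n)\<close> belongs to at least one.\<close>

lemma infinite_strongly_discrete: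
  assumes inf: "infinite C" and C: "\<And>u. u \<in> C \<Longrightarrow> ultrafilter u"
  obtains p :: "nat \<Rightarrow> 'a set set" where "strongly_discrete p" "\<forall>n. p n \<in> C"
proof -
  define I where "I R \<longleftrightarrow> infinite {u \<in> C. R \<in> u}" for R
  have step: "\<exists>R'. I R' \<and> (R' \<subseteq> R \<and> (\<exists>u\<in>C. R - R' \<in> u))" if "I R" for R
  proof -
    have "{u \<in> C. R \<in> u} \<noteq> {}" using \<open>I R\<close> unfolding I_def by (rule infinite_imp_nonempty)
    then obtain u where u: "u \<in> C" "R \<in> u" by blast
    have "infinite ({u \<in> C. R \<in> u} - {u})" using \<open>I R\<close> unfolding I_def by simp
    then have "{u \<in> C. R \<in> u} - {u} \<noteq> {}" by (rule infinite_imp_nonempty)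
    then obtain v where v: "v \<in> C" "R \<in> v" "u \<noteq> v" by blast
    obtain A where A: "A \<in> u" "A \<notin> v"
      using ultrafilters_separated[OF C[OF u(1)] C[OF v(1)] v(3)] .
    have "{u \<in> C. R \<in> u} = {u \<in> C. R \<inter> A \<in> u} \<union> {u \<in> C. R - A \<in> u}"
      using C by (auto simp: ultrafilter_Int ultrafilter_Diff)
    then have "I (R \<inter> A) \<or> I (R - A)" using \<open>I R\<close> by (auto simp: I_def)
    then show ?thesis
    proof
      assume "I (R \<inter> A)"
      moreover have "R - R \<inter> A \<in> v" using C A v by (simp add: ultrafilter_Diff ultrafilter_Int)
      ultimately show ?thesis using v(1) by (intro exI[of _ "R \<inter> A"]) blast
    next
      assume "I (R - A)"
      moreover have "R - (R - A) \<in> u" using C A u by (simp add: ultrafilter_Diff)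
      ultimately show ?thesis using u(1) by (intro exI[of _ "R - A"]) blast
    qed
  qed
  have "I UNIV"
  proof -
    have "{u \<in> C. UNIV \<in> u} = C" using C ultrafilter_UNIV by blast
    then show ?thesis using inf by (simp add: I_def)
  qed
  then have ex: "\<exists>R. I R" ..
  have "\<exists>R. \<forall>n. I (R n) \<and> (R (Suc n) \<subseteq> R n \<and> (\<exists>u\<in>C. R n - R (Suc n) \<in> u))"
    by (rule dependent_nat_choice[where P = "\<lambda>_. I"
          and Q = "\<lambda>_ R R'. R' \<subseteq> R \<and> (\<exists>u\<in>C. R - R' \<in> u)", OF ex step])
  then obtain R
    where "\<forall>n. I (R n) \<and> (R (Suc n) \<subseteq> R n \<and> (\<exists>u\<in>C. R n - R (Suc n) \<in> u))"
    by (rule exE)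
  then have R: "R (Suc n) \<subseteq> R n" "\<exists>u\<in>C. R n - R (Suc n) \<in> u" for n by simp_all
  from R(2) obtain p where p: "\<And>n. p n \<in> C" "\<And>n. R n - R (Suc n) \<in> p n" by metis
  have anti: "R n \<subseteq> R m" if "m \<le> n" for m n using lift_Suc_antimono_le[of R, OF R(1) that] .
  have disj: "(R m - R (Suc m)) \<inter> (R n - R (Suc n)) = {}" if "m < n" for m n
    using anti[of "Suc m" n] that by auto
  have "disjoint_family (\<lambda>n. R n - R (Suc n))"
    unfolding disjoint_family_on_def
  proof (intro ballI impI)
    fix m n :: nat assume "m \<noteq> n"
    then show "(R m - R (Suc m)) \<inter> (R n - R (Suc n)) = {}"
      using disj[of m n] disj[of n m] by (cases "m < n") (simp_all add: Int_commute)
  qed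
  then have "strongly_discrete p"
    unfolding strongly_discrete_def using p(2) C[OF p(1)] by blast
  with p(1) that show thesis by blast
qed

section \<open>Choosing limit points injectively\<close>

text \<open>By recursion along a well-order of the index type whose proper initial segments are smaller
  than the type, and hence smaller than each \<open>S i\<close>.\<close>

lemma injective_choice:
  includes cardinal_syntax
  fixes S :: "'i \<Rightarrow> 'a set"
  assumes "\<And>i. |UNIV :: 'i set| \<le>o |S i|"
  obtains g where "inj g" "\<forall>i. g i \<in> S i"
proof -
  define r where "r = |UNIV :: 'i set|"
  have wo: "wo_rel r" unfolding r_def by (simp add: wo_rel_def card_of_Well_order)
  define lt where "lt = r - Id"
  have wf: "wf lt" unfolding lt_def by (rule wo_rel.WF[OF wo])
  define g where "g = wfrec lt (\<lambda>g i. SOME x. x \<in> S i \<and> x \<notin> g ` {j. (j, i) \<in> lt})"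
  have gi: "g i = (SOME x. x \<in> S i \<and> x \<notin> g ` {j. (j, i) \<in> lt})" for i
  proof -
    have "cut g lt i ` {j. (j, i) \<in> lt} = g ` {j. (j, i) \<in> lt}"
      by (intro image_cong) (auto simp: cut_apply)
    then show ?thesis unfolding g_def by (subst wfrec[OF wf]) (simp add: g_def)
  qed
  have g: "g i \<in> S i \<and> g i \<notin> g ` {j. (j, i) \<in> lt}" for i
  proof -
    have "{j. (j, i) \<in> lt} = underS r i" by (auto simp: lt_def underS_def)
    moreover have "|underS r i| <o r"
      unfolding r_def by (rule card_of_underS[OF card_of_Card_order]) (simp add: Field_card_of)
    ultimately have "|g ` {j. (j, i) \<in> lt}| <o r"
      by (metis card_of_image ordLeq_ordLess_trans)
    also have "r \<le>o |S i|" unfolding r_def by (rule assms)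
    finally have "|g ` {j. (j, i) \<in> lt}| <o |S i|" .
    then have "\<not> S i \<subseteq> g ` {j. (j, i) \<in> lt}"
      using card_of_mono1 not_ordLess_ordLeq by blast
    then have "\<exists>x. x \<in> S i \<and> x \<notin> g ` {j. (j, i) \<in> lt}" by blast
    then show ?thesis unfolding gi[of i] by (rule someI_ex)
  qed
  have "inj g"
  proof (rule injI, rule ccontr)
    fix i j assume eq: "g i = g j" and "i \<noteq> j"
    moreover have "(i, j) \<in> r \<or> (j, i) \<in> r"
      using wo_rel.TOTALS[OF wo] by (auto simp: r_def Field_card_of)
    ultimately have "(i, j) \<in> lt \<or> (j, i) \<in> lt" by (auto simp: lt_def)
    then have "g i \<in> g ` {k. (k, j) \<in> lt} \<or> g j \<in> g ` {k. (k, i) \<in> lt}" by blast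
    then show False using g[of i] g[of j] eq by simp
  qed
  with g that show thesis by blast
qed

text \<open>The pair of \<open>p\<close> and \<open>j\<close> is coded by tagging the elements of \<open>p n\<close> with \<open>Suc n\<close>, and \<open>{j}\<close> with
  \<open>0\<close>.\<close>

lemma inj_sequences_into_sets:
  "\<exists>h :: (nat \<Rightarrow> nat set set) \<times> nat \<Rightarrow> nat set set. inj h"
proof -
  \<comment> \<open>The additional element makes the tag \<open>n\<close> recoverable when \<open>A\<close> is empty.\<close>
  define code where "code n A = insert (prod_encode (n, 0)) ((\<lambda>m. prod_encode (n, Suc m)) ` A)"
    for n A
  have code: "code n A = code m B \<longleftrightarrow> n = m \<and> A = B" for n m A B
  proof
    assume eq: "code n A = code m B"
    have "prod_encode (n, 0) \<in> code n A" by (simp add: code_def)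
    then have "prod_encode (n, 0) \<in> code m B" by (simp only: eq)
    then have "n = m" by (auto simp: code_def)
    have mem: "prod_encode (n, Suc k) \<in> code n A \<longleftrightarrow> k \<in> A" for n k A
      by (auto simp: code_def)
    show "n = m \<and> A = B" using mem eq \<open>n = m\<close> by blast
  qed simp
  define h where "h = (\<lambda>(p, j). {code (Suc n) A |n A. A \<in> p n} \<union> {code 0 {j}})"
  have "inj h"
  proof (rule injI)
    fix x y assume eq: "h x = h y"
    obtain p j q k where xy: "x = (p, j)" "y = (q, k)" by fastforce
    have 1: "code (Suc n) A \<in> h (p, j) \<longleftrightarrow> A \<in> p n" and 2: "code 0 {i} \<in> h (p, j) \<longleftrightarrow> i = j"
      for p n A i j by (auto simp: h_def code)
    have "p = q" using eq 1[of _ _ p j] 1[of _ _ q k] unfolding xy by (intro ext set_eqI) simp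
    moreover have "j = k" using eq 2[of j p j] 2[of j q k] unfolding xy by simp
    ultimately show "x = y" by (simp add: xy)
  qed
  then show ?thesis by blast
qed

text \<open>Bernstein's construction: the sequences of ultrafilters are no more numerous than the limit
  points of any single strongly discrete one.\<close>

lemma disjoint_sets_of_limits:
  includes cardinal_syntax
  obtains P :: "nat \<Rightarrow> nat set set set"
  where "disjoint_family P" "\<forall>j. P j \<subseteq> Collect ultrafilter"
    "\<forall>p :: nat \<Rightarrow> nat set set. strongly_discrete p \<longrightarrow> (\<forall>j. \<exists>u. ultrafilter u \<and> ulim u p \<in> P j)"
proof -
  obtain h :: "(nat \<Rightarrow> nat set set) \<times> nat \<Rightarrow> nat set set" where h: "inj h"
    using inj_sequences_into_sets by blast
  obtain U :: "nat set set \<Rightarrow> nat set set" where U: "inj U" "\<And>S. ultrafilter (U S)"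
    using many_ultrafilters by blast
  \<comment> \<open>For the other sequences the choice is irrelevant; \<open>UNIV\<close> makes it possible.\<close>
  define S :: "(nat \<Rightarrow> nat set set) \<times> nat \<Rightarrow> nat set set set" where
    "S = (\<lambda>(p, j). if strongly_discrete p then (\<lambda>u. ulim u p) ` Collect ultrafilter else UNIV)"
  have "|UNIV :: ((nat \<Rightarrow> nat set set) \<times> nat) set| \<le>o |S i|" for i
  proof (cases "strongly_discrete (fst i)")
    case True
    have "inj_on (\<lambda>u. ulim u (fst i)) (range (U \<circ> h))"
      using inj_on_ulim[OF True] by (rule inj_on_subset) (use U(2) in auto)
    then have "inj ((\<lambda>u. ulim u (fst i)) \<circ> (U \<circ> h))"
      using h U(1) by (intro comp_inj_on inj_on_subset[OF U(1)]) auto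
    moreover have "range ((\<lambda>u. ulim u (fst i)) \<circ> (U \<circ> h)) \<subseteq> S i"
      using True U(2) by (auto simp: S_def case_prod_beta)
    ultimately show ?thesis using card_of_ordLeq by blast
  next
    case False
    then have "S i = UNIV" by (simp add: S_def case_prod_beta)
    then show ?thesis using h card_of_ordLeq by blast
  qed
  from injective_choice[of S, OF this] obtain g where "inj g" "\<forall>i. g i \<in> S i" .
  then have g: "inj g" "g i \<in> S i" for i by blast+
  define P where "P j = {g (p, j) |p :: nat \<Rightarrow> nat set set. strongly_discrete p}" for j
  show thesis
  proof
    show "disjoint_family P"
      using g(1) by (auto simp: disjoint_family_on_def P_def dest: injD)
    show "\<forall>j. P j \<subseteq> Collect ultrafilter"
    proof (intro allI subsetI)
      fix j x assume "x \<in> P j"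
      then obtain p where p: "x = g (p, j)" "strongly_discrete p" by (auto simp: P_def)
      then obtain u where "ultrafilter u" "x = ulim u p"
        using g(2)[of "(p, j)"] by (auto simp: S_def)
      then show "x \<in> Collect ultrafilter"
        using p(2) ultrafilter_ulim by (auto simp: strongly_discrete_def)
    qed
    show "\<forall>p :: nat \<Rightarrow> nat set set. strongly_discrete p \<longrightarrow> (\<forall>j. \<exists>u. ultrafilter u \<and> ulim u p \<in> P j)"
    proof (intro allI impI)
      fix p :: "nat \<Rightarrow> nat set set" and j
      assume p: "strongly_discrete p"
      then have "g (p, j) \<in> P j" by (auto simp: P_def)
      then show "\<exists>u. ultrafilter u \<and> ulim u p \<in> P j" using g(2)[of "(p, j)"] p by (auto simp: S_def)
    qed
  qed
qed

section \<open>The two factors and their product\<close>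

lemma Staeckel_compact_stone_subspace:
  fixes A B Y :: "nat set set set"
  assumes "A \<subseteq> Y" "B \<subseteq> Y" "A \<inter> B = {}" "Y \<subseteq> Collect ultrafilter"
    and A: "\<And>p :: nat \<Rightarrow> nat set set. strongly_discrete p \<Longrightarrow> \<exists>u. ultrafilter u \<and> ulim u p \<in> A"
    and B: "\<And>p :: nat \<Rightarrow> nat set set. strongly_discrete p \<Longrightarrow> \<exists>u. ultrafilter u \<and> ulim u p \<in> B"
  shows "Staeckel_compact_space (subtopology stone_topology Y)"
proof (rule Staeckel_compact_if_split[where A = A])
  show "Hausdorff_space (subtopology stone_topology Y)"
    by (simp add: Hausdorff_stone_topology Hausdorff_space_subtopology)
  fix C assume C: "closedin (subtopology stone_topology Y) C" "infinite C"
  have "C \<subseteq> Y" using closedin_subset[OF C(1)] by auto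
  then have "ultrafilter u" if "u \<in> C" for u using assms(4) that by blast
  from infinite_strongly_discrete[OF C(2) this]
  obtain p :: "nat \<Rightarrow> nat set set" where "strongly_discrete p" "\<forall>n. p n \<in> C" .
  then have p: "strongly_discrete p" "p n \<in> C" for n by simp_all
  have in_C: "ulim u p \<in> C" if "ultrafilter u" "ulim u p \<in> Y" for u
    by (rule ulim_in_closed[OF C(1) p(2) that])
  obtain u v where "ultrafilter u" "ulim u p \<in> A" "ultrafilter v" "ulim v p \<in> B"
    using A[OF p(1)] B[OF p(1)] by blast
  then show "C \<inter> A \<noteq> {} \<and> C - A \<noteq> {}" using in_C assms(1-3) by blast
qed

text \<open>The open cover consists of the complement of the diagonal and the singletons of its points.\<close>

lemma not_countably_compact_product:
  assumes YZ: "Y \<inter> Z = range principal_uf"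
    and uf: "Y \<union> Z \<subseteq> Collect (ultrafilter :: nat set set \<Rightarrow> bool)"
  shows "\<not> countably_compact_space
     (prod_topology (subtopology stone_topology Y) (subtopology stone_topology Z))"
proof
  define X where "X = prod_topology (subtopology stone_topology Y) (subtopology stone_topology Z)"
  assume "countably_compact_space
     (prod_topology (subtopology stone_topology Y) (subtopology stone_topology Z))"
  then have cc: "countably_compact_space X" by (simp add: X_def)
  have top: "topspace X = Y \<times> Z"
    using uf by (auto simp: X_def topspace_stone_topology)
  define b where "b W A = {u. ultrafilter u \<and> A \<in> u} \<inter> W" for W and A :: "nat set"
  have openb: "openin X (b Y A \<times> b Z B)" for A B
    unfolding X_def openin_prod_Times_iff b_def
    by (intro disjI2 conjI openin_subtopology_Int openin_stone_basic)
  \<comment> \<open>The points of the diagonal, and its complement: \<open>u \<noteq> v\<close> if and only if some \<open>A\<close> belongs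
      to \<open>u\<close> and its complement to \<open>v\<close>.\<close>
  define d where "d n = {(principal_uf n, principal_uf n)}" for n :: nat
  define off where "off = (\<Union>A. b Y A \<times> b Z (- A))"
  have b_single: "b W {n} = {principal_uf n}" if "principal_uf n \<in> W" for W n
    using that by (auto simp: b_def ultrafilter_singleton ultrafilter_principal_uf)
  have "openin X (d n)" for n
  proof -
    have "principal_uf n \<in> Y" "principal_uf n \<in> Z" using YZ by auto
    then show ?thesis using openb[of "{n}" "{n}"] by (simp add: b_single d_def)
  qed
  moreover have "openin X off" using openb by (auto simp: off_def)
  moreover have cover: "topspace X \<subseteq> off \<union> \<Union>(range d)"
  proof
    fix x assume "x \<in> topspace X"
    then obtain u v where x: "x = (u, v)" "u \<in> Y" "v \<in> Z" by (auto simp: top)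
    then have uv: "ultrafilter u" "ultrafilter v" using uf by auto
    show "x \<in> off \<union> \<Union>(range d)"
    proof (cases "u = v")
      case True
      then show ?thesis using x YZ by (auto simp: d_def)
    next
      case False
      with uv obtain A where "A \<in> u" "A \<notin> v" by (rule ultrafilters_separated)
      then show ?thesis using x uv by (auto simp: off_def b_def ultrafilter_Compl)
    qed
  qed
  ultimately have "countable (insert off (range d)) \<and> (\<forall>U\<in>insert off (range d). openin X U) \<and>
      topspace X \<subseteq> \<Union>(insert off (range d))" by auto
  then obtain \<F> where \<F>: "finite \<F>" "\<F> \<subseteq> insert off (range d)" "topspace X \<subseteq> \<Union>\<F>"
    using cc unfolding countably_compact_space_def by meson
  have dF: "d n \<in> \<F>" for n
  proof -
    have "(principal_uf n, principal_uf n) \<in> topspace X" using YZ by (auto simp: top)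
    then obtain U where U: "U \<in> \<F>" "(principal_uf n, principal_uf n) \<in> U" using \<F>(3) by blast
    have "(principal_uf n, principal_uf n) \<notin> off" by (auto simp: off_def b_def ultrafilter_Compl)
    then have "U \<in> range d" using U \<F>(2) by auto
    then obtain m where m: "U = d m" by blast
    with U(2) have "principal_uf n = principal_uf m" by (simp add: d_def)
    with m U(1) show ?thesis by (simp add: d_def)
  qed
  have "inj d" using inj_principal_uf by (auto simp: d_def inj_def)
  then have "infinite (range d)" by (simp add: finite_image_iff)
  moreover have "range d \<subseteq> \<F>" using dF by blast
  ultimately show False using \<F>(1) finite_subset by blast
qed

theorem corollary6p6:
  shows "\<exists>(Y :: nat set set topology) (Z :: nat set set topology).
           Staeckel_compact_space Y \<and> Staeckel_compact_space Z \<and>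
           \<not> countably_compact_space (prod_topology Y Z) \<and>
           \<not> Staeckel_compact_space (prod_topology Y Z)"
proof -
  obtain P :: "nat \<Rightarrow> nat set set set"
    where P: "disjoint_family P" "\<forall>j. P j \<subseteq> Collect ultrafilter"
      "\<forall>p :: nat \<Rightarrow> nat set set. strongly_discrete p \<longrightarrow> (\<forall>j. \<exists>u. ultrafilter u \<and> ulim u p \<in> P j)"
    by (rule disjoint_sets_of_limits)
  have disj: "P i \<inter> P j = {}" if "i \<noteq> j" for i j
    using P(1) that by (auto simp: disjoint_family_on_def)
  define Y where "Y = range principal_uf \<union> P 0 \<union> P 1"
  define Z where "Z = range principal_uf \<union> P 2 \<union> P 3"
  have uf: "Y \<subseteq> Collect ultrafilter" "Z \<subseteq> Collect ultrafilter"
    using P(2) ultrafilter_principal_uf by (auto simp: Y_def Z_def)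
  have "Staeckel_compact_space (subtopology stone_topology Y)"
    by (rule Staeckel_compact_stone_subspace[of "P 0" _ "P 1"])
      (use P(3) disj uf in \<open>auto simp: Y_def\<close>)
  moreover have "Staeckel_compact_space (subtopology stone_topology Z)"
    by (rule Staeckel_compact_stone_subspace[of "P 2" _ "P 3"])
      (use P(3) disj uf in \<open>auto simp: Z_def\<close>)
  moreover have "Y \<inter> Z = range principal_uf"
    using disj[of 0 2] disj[of 0 3] disj[of 1 2] disj[of 1 3] by (auto simp: Y_def Z_def)
  then have "\<not> countably_compact_space
      (prod_topology (subtopology stone_topology Y) (subtopology stone_topology Z))"
    using uf by (intro not_countably_compact_product) auto
  moreover from this have "\<not> Staeckel_compact_space
      (prod_topology (subtopology stone_topology Y) (subtopology stone_topology Z))"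
    using Staeckel_compact_imp_countably_compact by (rule contrapos_nn)
  ultimately show ?thesis by (intro exI conjI)
qed

end
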